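(* Let $A$ be a unital algebra over a commutative ring $\mathbb{K}$, let $\Delta\in A$, and let $c,d$ be any invertible elements of $A$. Then $\Delta$ is well-tempered if and only if $\Delta'=c\Delta d$ is well-tempered.
   Context: Algebras over $\mathbb{K}$ are associative and assumed to be free as $\mathbb{K}$-modules. Homotope: for a unital $\mathbb{K}$-algebra $A$ and $\Delta\in A$, $B^+=A_\Delta$ is the algebra with underlying module $A$ and multiplication $a\cdot_\Delta b=a\Delta b$; $B=\widehat{A}_\Delta=\mathbb{K}\cdot 1\oplus B^+$ is obtained by adjoining a unit, so $B^+$ is a two-sided ideal of $B$. Well-tempered: $\Delta\in A$ is well-tempered if the multiplication map $B^+\otimes_{\mathbb{K}}B^+\to B^+$ is surjective (equivalently $A\Delta A=A$, the two-sided ideal generated by $\Delta$ being all of $A$) and $B^+$ is projective both as a left and as a right $B$-module. *)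

theory Defs
  imports "HOL-Algebra.Module" "HOL-Algebra.Ideal"
begin

section \<open>Modules over a possibly noncommutative ring\<close>

text \<open>
  The locale \<^locale>\<open>module\<close> of HOL-Algebra requires a commutative base ring and the locale
  \<^locale>\<open>algebra\<close> a commutative algebra; neither is adequate here.  The records and
  \<^locale>\<open>submodule\<close> carry no such restriction and are reused.  In a record that serves only
  as a module, the fields \<open>mult\<close> and \<open>one\<close> are junk.
\<close>

locale left_module = R?: ring R + M?: abelian_group M
  for R :: "('a, 'r) ring_scheme" (structure) and M :: "('a, 'b, 'm) module_scheme" (structure) +
  assumes smult_closed:
      "\<lbrakk>a \<in> carrier R; x \<in> carrier M\<rbrakk> \<Longrightarrow> a \<odot>\<^bsub>M\<^esub> x \<in> carrier M"
    and smult_l_distr: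
      "\<lbrakk>a \<in> carrier R; b \<in> carrier R; x \<in> carrier M\<rbrakk> \<Longrightarrow>
        (a \<oplus> b) \<odot>\<^bsub>M\<^esub> x = a \<odot>\<^bsub>M\<^esub> x \<oplus>\<^bsub>M\<^esub> b \<odot>\<^bsub>M\<^esub> x"
    and smult_r_distr:
      "\<lbrakk>a \<in> carrier R; x \<in> carrier M; y \<in> carrier M\<rbrakk> \<Longrightarrow>
        a \<odot>\<^bsub>M\<^esub> (x \<oplus>\<^bsub>M\<^esub> y) = a \<odot>\<^bsub>M\<^esub> x \<oplus>\<^bsub>M\<^esub> a \<odot>\<^bsub>M\<^esub> y"
    and smult_assoc1:
      "\<lbrakk>a \<in> carrier R; b \<in> carrier R; x \<in> carrier M\<rbrakk> \<Longrightarrow>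
        (a \<otimes> b) \<odot>\<^bsub>M\<^esub> x = a \<odot>\<^bsub>M\<^esub> (b \<odot>\<^bsub>M\<^esub> x)"
    and smult_one: "x \<in> carrier M \<Longrightarrow> \<one> \<odot>\<^bsub>M\<^esub> x = x"

definition module_hom ::
  "('a, 'r) ring_scheme \<Rightarrow> ('a, 'b, 'm) module_scheme \<Rightarrow> ('a, 'c, 'n) module_scheme \<Rightarrow> ('b \<Rightarrow> 'c) set"
  where "module_hom R M N =
    {h \<in> carrier M \<rightarrow> carrier N.
      (\<forall>x \<in> carrier M. \<forall>y \<in> carrier M. h (x \<oplus>\<^bsub>M\<^esub> y) = h x \<oplus>\<^bsub>N\<^esub> h y) \<and>
      (\<forall>a \<in> carrier R. \<forall>x \<in> carrier M. h (a \<odot>\<^bsub>M\<^esub> x) = a \<odot>\<^bsub>N\<^esub> h x)}"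

text \<open>The module \<open>R\<^sup>(\<^sup>I\<^sup>)\<close> of finitely supported families.\<close>

definition free_module :: "('a, 'r) ring_scheme \<Rightarrow> 'i set \<Rightarrow> ('a, 'i \<Rightarrow> 'a) module"
  where "free_module R I =
    \<lparr>carrier = {f. (\<forall>i. f i \<in> carrier R) \<and> (\<forall>i. i \<notin> I \<longrightarrow> f i = \<zero>\<^bsub>R\<^esub>) \<and>
                   finite {i. f i \<noteq> \<zero>\<^bsub>R\<^esub>}},
     mult = undefined, one = undefined,
     zero = (\<lambda>i. \<zero>\<^bsub>R\<^esub>), add = (\<lambda>f g i. f i \<oplus>\<^bsub>R\<^esub> g i),
     smult = (\<lambda>a f i. a \<otimes>\<^bsub>R\<^esub> f i)\<rparr>"

definition free_basis :: "('a, 'r) ring_scheme \<Rightarrow> 'i \<Rightarrow> 'i \<Rightarrow> 'a"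
  where "free_basis R i = (\<lambda>j. if j = i then \<one>\<^bsub>R\<^esub> else \<zero>\<^bsub>R\<^esub>)"

definition linear_extension ::
  "('a, 'r) ring_scheme \<Rightarrow> ('a, 'b, 'm) module_scheme \<Rightarrow> ('i \<Rightarrow> 'b) \<Rightarrow> ('i \<Rightarrow> 'a) \<Rightarrow> 'b"
  where "linear_extension R M \<phi> f = (\<Oplus>\<^bsub>M\<^esub>i \<in> {i. f i \<noteq> \<zero>\<^bsub>R\<^esub>}. f i \<odot>\<^bsub>M\<^esub> \<phi> i)"

text \<open>
  In the next two definitions the index set of the free module is taken in the element type
  of the module.  This is no restriction: a basis embeds into a free module over a nontrivial
  ring, and every module is a quotient of the free module on its own carrier.
\<close>

definition is_free_module :: "('a, 'r) ring_scheme \<Rightarrow> ('a, 'b, 'm) module_scheme \<Rightarrow> bool"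
  where "is_free_module R M \<longleftrightarrow> left_module R M \<and>
    (\<exists>(I :: 'b set) h. h \<in> module_hom R M (free_module R I) \<and>
       bij_betw h (carrier M) (carrier (free_module R I)))"

text \<open>Projective modules: those isomorphic to a direct summand of a free module.\<close>

definition is_projective_module :: "('a, 'r) ring_scheme \<Rightarrow> ('a, 'b, 'm) module_scheme \<Rightarrow> bool"
  where "is_projective_module R P \<longleftrightarrow> left_module R P \<and>
    (\<exists>(I :: 'b set) h N N'. let F = free_module R I in
       submodule N R F \<and> submodule N' R F \<and>
       N <+>\<^bsub>F\<^esub> N' = carrier F \<and> N \<inter> N' = {\<zero>\<^bsub>F\<^esub>} \<and>
       h \<in> module_hom R P F \<and> bij_betw h (carrier P) N)"

text \<open>Right modules over \<open>R\<close> are treated as left modules over the opposite ring.\<close>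

definition opposite_ring :: "('a, 'r) ring_scheme \<Rightarrow> ('a, 'r) ring_scheme"
  where "opposite_ring R = R\<lparr>mult := (\<lambda>x y. y \<otimes>\<^bsub>R\<^esub> x)\<rparr>"

text \<open>
  A left ideal \<open>J\<close> of \<open>R\<close> as a left \<open>R\<close>-module.  Applied to \<^term>\<open>opposite_ring R\<close>, this
  yields a right ideal of \<open>R\<close> as a right \<open>R\<close>-module.
\<close>

definition ideal_module :: "('a, 'r) ring_scheme \<Rightarrow> 'a set \<Rightarrow> ('a, 'a) module"
  where "ideal_module R J =
    \<lparr>carrier = J, mult = undefined, one = undefined, zero = \<zero>\<^bsub>R\<^esub>, add = add R, smult = mult R\<rparr>"


section \<open>Tensor products over a commutative ring\<close>

definition module_span ::
  "('a, 'r) ring_scheme \<Rightarrow> ('a, 'b, 'm) module_scheme \<Rightarrow> 'b set \<Rightarrow> 'b set"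
  where "module_span R M S = \<Inter>{H. submodule H R M \<and> S \<subseteq> H}"

definition quotient_module ::
  "('a, 'r) ring_scheme \<Rightarrow> ('a, 'b, 'm) module_scheme \<Rightarrow> 'b set \<Rightarrow> ('a, 'b set) module"
  where "quotient_module R M N =
    \<lparr>carrier = a_rcosets\<^bsub>M\<^esub> N, mult = undefined, one = undefined,
     zero = N, add = set_add M,
     smult = (\<lambda>a X. \<Union>x \<in> X. N +>\<^bsub>M\<^esub> (a \<odot>\<^bsub>M\<^esub> x))\<rparr>"

definition tensor_relations ::
  "('k, 'r) ring_scheme \<Rightarrow> ('k, 'b, 'm) module_scheme \<Rightarrow> ('k, 'c, 'n) module_scheme
    \<Rightarrow> ('b \<times> 'c \<Rightarrow> 'k) set"
  where "tensor_relations K M N =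
    (let F = free_module K (carrier M \<times> carrier N); e = free_basis K in
      {e (x \<oplus>\<^bsub>M\<^esub> x', y) \<ominus>\<^bsub>F\<^esub> (e (x, y) \<oplus>\<^bsub>F\<^esub> e (x', y)) | x x' y.
         x \<in> carrier M \<and> x' \<in> carrier M \<and> y \<in> carrier N} \<union>
      {e (x, y \<oplus>\<^bsub>N\<^esub> y') \<ominus>\<^bsub>F\<^esub> (e (x, y) \<oplus>\<^bsub>F\<^esub> e (x, y')) | x y y'.
         x \<in> carrier M \<and> y \<in> carrier N \<and> y' \<in> carrier N} \<union>
      {e (r \<odot>\<^bsub>M\<^esub> x, y) \<ominus>\<^bsub>F\<^esub> (r \<odot>\<^bsub>F\<^esub> e (x, y)) | r x y.
         r \<in> carrier K \<and> x \<in> carrier M \<and> y \<in> carrier N} \<union>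
      {e (x, r \<odot>\<^bsub>N\<^esub> y) \<ominus>\<^bsub>F\<^esub> (r \<odot>\<^bsub>F\<^esub> e (x, y)) | r x y.
         r \<in> carrier K \<and> x \<in> carrier M \<and> y \<in> carrier N})"

definition tensor_kernel ::
  "('k, 'r) ring_scheme \<Rightarrow> ('k, 'b, 'm) module_scheme \<Rightarrow> ('k, 'c, 'n) module_scheme
    \<Rightarrow> ('b \<times> 'c \<Rightarrow> 'k) set"
  where "tensor_kernel K M N =
    module_span K (free_module K (carrier M \<times> carrier N)) (tensor_relations K M N)"

definition tensor_product ::
  "('k, 'r) ring_scheme \<Rightarrow> ('k, 'b, 'm) module_scheme \<Rightarrow> ('k, 'c, 'n) module_scheme
    \<Rightarrow> ('k, ('b \<times> 'c \<Rightarrow> 'k) set) module"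
  where "tensor_product K M N =
    quotient_module K (free_module K (carrier M \<times> carrier N)) (tensor_kernel K M N)"

definition pure_tensor ::
  "('k, 'r) ring_scheme \<Rightarrow> ('k, 'b, 'm) module_scheme \<Rightarrow> ('k, 'c, 'n) module_scheme
    \<Rightarrow> 'b \<Rightarrow> 'c \<Rightarrow> ('b \<times> 'c \<Rightarrow> 'k) set"
  where "pure_tensor K M N x y =
    tensor_kernel K M N +>\<^bsub>free_module K (carrier M \<times> carrier N)\<^esub> free_basis K (x, y)"

text \<open>
  The linear map on \<^term>\<open>tensor_product K M N\<close> induced by a bilinear map \<open>\<beta>\<close> into \<open>P\<close>.  For
  bilinear \<open>\<beta>\<close>, the set under \<^const>\<open>the_elem\<close> is a singleton; see
  \<open>tensor_lift_coset\<close>, \<open>tensor_lift_pure_tensor\<close> and \<open>tensor_lift_hom\<close> below.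
\<close>

definition tensor_lift ::
  "('k, 'r) ring_scheme \<Rightarrow> ('k, 'p, 'q) module_scheme \<Rightarrow> ('b \<Rightarrow> 'c \<Rightarrow> 'p)
    \<Rightarrow> ('b \<times> 'c \<Rightarrow> 'k) set \<Rightarrow> 'p"
  where "tensor_lift K P \<beta> X = the_elem (linear_extension K P (\<lambda>(x, y). \<beta> x y) ` X)"


section \<open>Algebras, homotopes and well-tempered elements\<close>

locale unital_algebra = module K A + A?: ring A
  for K (structure) and A (structure) +
  assumes smult_assoc_l:
      "\<lbrakk>r \<in> carrier K; x \<in> carrier A; y \<in> carrier A\<rbrakk> \<Longrightarrow>
        (r \<odot>\<^bsub>A\<^esub> x) \<otimes>\<^bsub>A\<^esub> y = r \<odot>\<^bsub>A\<^esub> (x \<otimes>\<^bsub>A\<^esub> y)"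
    and smult_assoc_r:
      "\<lbrakk>r \<in> carrier K; x \<in> carrier A; y \<in> carrier A\<rbrakk> \<Longrightarrow>
        x \<otimes>\<^bsub>A\<^esub> (r \<odot>\<^bsub>A\<^esub> y) = r \<odot>\<^bsub>A\<^esub> (x \<otimes>\<^bsub>A\<^esub> y)"

text \<open>The homotope is in general not unital, so its field \<open>one\<close> is junk.\<close>

definition homotope :: "('k, 'a, 'm) module_scheme \<Rightarrow> 'a \<Rightarrow> ('k, 'a, 'm) module_scheme"
  where "homotope A \<Delta> = A\<lparr>mult := (\<lambda>a b. a \<otimes>\<^bsub>A\<^esub> \<Delta> \<otimes>\<^bsub>A\<^esub> b), one := undefined\<rparr>"

text \<open>
  \<open>K \<cdot> 1 \<oplus> C\<close> for a possibly nonunital algebra \<open>C\<close>; the pair \<open>(r, x)\<close> stands for \<open>r \<cdot> 1 + x\<close>.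
\<close>

definition adjoin_unit ::
  "('k, 'r) ring_scheme \<Rightarrow> ('k, 'a, 'm) module_scheme \<Rightarrow> ('k, 'k \<times> 'a) module"
  where "adjoin_unit K C =
    \<lparr>carrier = carrier K \<times> carrier C,
     mult = (\<lambda>(r, x) (s, y).
       (r \<otimes>\<^bsub>K\<^esub> s, r \<odot>\<^bsub>C\<^esub> y \<oplus>\<^bsub>C\<^esub> s \<odot>\<^bsub>C\<^esub> x \<oplus>\<^bsub>C\<^esub> x \<otimes>\<^bsub>C\<^esub> y)),
     one = (\<one>\<^bsub>K\<^esub>, \<zero>\<^bsub>C\<^esub>),
     zero = (\<zero>\<^bsub>K\<^esub>, \<zero>\<^bsub>C\<^esub>),
     add = (\<lambda>(r, x) (s, y). (r \<oplus>\<^bsub>K\<^esub> s, x \<oplus>\<^bsub>C\<^esub> y)),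
     smult = (\<lambda>r (s, x). (r \<otimes>\<^bsub>K\<^esub> s, r \<odot>\<^bsub>C\<^esub> x))\<rparr>"

definition augmentation_ideal ::
  "('k, 'r) ring_scheme \<Rightarrow> ('k, 'a, 'm) module_scheme \<Rightarrow> ('k \<times> 'a) set"
  where "augmentation_ideal K C = {\<zero>\<^bsub>K\<^esub>} \<times> carrier C"

definition well_tempered ::
  "('k, 'r) ring_scheme \<Rightarrow> ('k, 'a, 'm) module_scheme \<Rightarrow> 'a \<Rightarrow> bool"
  where "well_tempered K A \<Delta> \<longleftrightarrow>
    (let C = homotope A \<Delta>; B = adjoin_unit K C; J = augmentation_ideal K C in
       tensor_lift K C (mult C) ` carrier (tensor_product K C C) = carrier C \<and>
       is_projective_module B (ideal_module B J) \<and>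
       is_projective_module (opposite_ring B) (ideal_module (opposite_ring B) J))"


section \<open>Consistency of the definitions\<close>

text \<open>
  The constructions above have the structure they are meant to have: free modules are modules,
  \<^const>\<open>tensor_lift\<close> is the linear map determined by \<open>x \<otimes> y \<mapsto> \<beta> x y\<close>, adjoining a unit to a
  homotope gives a ring, and the homotope is a two-sided ideal of it, hence a left module over it
  and over its opposite.
\<close>

lemma free_module_simps:
  "carrier (free_module R I) = {f. (\<forall>i. f i \<in> carrier R) \<and> (\<forall>i. i \<notin> I \<longrightarrow> f i = \<zero>\<^bsub>R\<^esub>) \<and> finite {i. f i \<noteq> \<zero>\<^bsub>R\<^esub>}}"
  "\<zero>\<^bsub>free_module R I\<^esub> = (\<lambda>i. \<zero>\<^bsub>R\<^esub>)"
  "f \<oplus>\<^bsub>free_module R I\<^esub> g = (\<lambda>i. f i \<oplus>\<^bsub>R\<^esub> g i)"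
  "a \<odot>\<^bsub>free_module R I\<^esub> f = (\<lambda>i. a \<otimes>\<^bsub>R\<^esub> f i)"
  by (simp_all add: free_module_def)

lemma left_module_free_module:
  assumes "ring R"
  shows "left_module R (free_module R I)"
proof -
  interpret R: ring R by fact
  let ?F = "free_module R I"
  have fin_add: "finite {i. f i \<oplus>\<^bsub>R\<^esub> g i \<noteq> \<zero>\<^bsub>R\<^esub>}"
    if "finite {i. f i \<noteq> \<zero>\<^bsub>R\<^esub>}" "finite {i. g i \<noteq> \<zero>\<^bsub>R\<^esub>}" for f g :: "'c \<Rightarrow> 'a"
    by (rule finite_subset[OF _ finite_UnI[OF that]]) auto
  have fin_smult: "finite {i. a \<otimes>\<^bsub>R\<^esub> f i \<noteq> \<zero>\<^bsub>R\<^esub>}"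
    if "finite {i. f i \<noteq> \<zero>\<^bsub>R\<^esub>}" "a \<in> carrier R" for a and f :: "'c \<Rightarrow> 'a"
    by (rule finite_subset[OF _ that(1)]) (auto simp: that(2))
  have neg: "\<exists>g\<in>carrier ?F. g \<oplus>\<^bsub>?F\<^esub> f = \<zero>\<^bsub>?F\<^esub>" if "f \<in> carrier ?F" for f
  proof (rule bexI)
    show "(\<lambda>i. \<ominus>\<^bsub>R\<^esub> f i) \<oplus>\<^bsub>?F\<^esub> f = \<zero>\<^bsub>?F\<^esub>"
      using that by (auto simp: free_module_simps R.l_neg)
    have "finite {i. \<ominus>\<^bsub>R\<^esub> f i \<noteq> \<zero>\<^bsub>R\<^esub>}"
      by (rule finite_subset[of _ "{i. f i \<noteq> \<zero>\<^bsub>R\<^esub>}"]) (use that in \<open>auto simp: free_module_simps\<close>)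
    then show "(\<lambda>i. \<ominus>\<^bsub>R\<^esub> f i) \<in> carrier ?F"
      using that by (simp add: free_module_simps)
  qed
  have "abelian_group ?F"
    by (rule abelian_groupI)
      (use neg in \<open>auto simp: free_module_simps fin_add R.a_ac\<close>)
  then interpret F: abelian_group ?F .
  show ?thesis
    by unfold_locales
      (auto simp: free_module_simps fin_smult R.l_distr R.r_distr R.m_assoc)
qed

lemma free_basis_closed:
  assumes "ring R" "i \<in> I"
  shows "free_basis R i \<in> carrier (free_module R I)"
proof -
  interpret R: ring R by fact
  have "finite {j. free_basis R i j \<noteq> \<zero>\<^bsub>R\<^esub>}"
    by (rule finite_subset[of _ "{i}"]) (auto simp: free_basis_def)
  then show ?thesis
    using assms(2) by (auto simp: free_module_simps free_basis_def)
qed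

context left_module
begin

lemma smult_zero_l: assumes "x \<in> carrier M" shows "\<zero> \<odot>\<^bsub>M\<^esub> x = \<zero>\<^bsub>M\<^esub>"
proof -
  have "\<zero> \<odot>\<^bsub>M\<^esub> x \<oplus>\<^bsub>M\<^esub> \<zero> \<odot>\<^bsub>M\<^esub> x = \<zero> \<odot>\<^bsub>M\<^esub> x"
    using smult_l_distr[of \<zero> \<zero> x] assms by simp
  then show ?thesis
    using assms by (metis M.add.r_cancel_one' R.zero_closed smult_closed)
qed

lemma smult_zero_r: assumes "a \<in> carrier R" shows "a \<odot>\<^bsub>M\<^esub> \<zero>\<^bsub>M\<^esub> = \<zero>\<^bsub>M\<^esub>"
proof -
  have "a \<odot>\<^bsub>M\<^esub> \<zero>\<^bsub>M\<^esub> \<oplus>\<^bsub>M\<^esub> a \<odot>\<^bsub>M\<^esub> \<zero>\<^bsub>M\<^esub> = a \<odot>\<^bsub>M\<^esub> \<zero>\<^bsub>M\<^esub>"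
    using smult_r_distr[of a "\<zero>\<^bsub>M\<^esub>" "\<zero>\<^bsub>M\<^esub>"] assms by simp
  then show ?thesis
    using assms by (metis M.add.r_cancel_one' M.zero_closed smult_closed)
qed

lemma finsum_smult:
  assumes "finite S" "a \<in> carrier R" "g \<in> S \<rightarrow> carrier M"
  shows "a \<odot>\<^bsub>M\<^esub> (\<Oplus>\<^bsub>M\<^esub>i\<in>S. g i) = (\<Oplus>\<^bsub>M\<^esub>i\<in>S. a \<odot>\<^bsub>M\<^esub> g i)"
  using assms(1,3)
proof (induction S rule: finite_induct)
  case empty then show ?case by (simp add: smult_zero_r assms(2))
next
  case (insert x S)
  have "g x \<in> carrier M" "g \<in> S \<rightarrow> carrier M" using insert by auto
  then show ?case using insert assms(2)
    by (simp add: smult_r_distr smult_closed Pi_def M.finsum_closed)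
qed

lemma linear_extension_support:
  assumes "\<phi> \<in> I \<rightarrow> carrier M" "f \<in> carrier (free_module R I)"
    and "finite S" "S \<subseteq> I" "{i. f i \<noteq> \<zero>} \<subseteq> S"
  shows "linear_extension R M \<phi> f = (\<Oplus>\<^bsub>M\<^esub>i\<in>S. f i \<odot>\<^bsub>M\<^esub> \<phi> i)"
  unfolding linear_extension_def
  by (rule M.add.finprod_mono_neutral_cong_left)
    (use assms in \<open>auto simp: free_module_simps smult_zero_l smult_closed Pi_def\<close>)

lemma linear_extension_hom:
  assumes \<phi>: "\<phi> \<in> I \<rightarrow> carrier M"
  shows "linear_extension R M \<phi> \<in> module_hom R (free_module R I) M"
proof -
  let ?F = "free_module R I" and ?L = "linear_extension R M \<phi>"
  interpret F: left_module R ?F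
    by (rule left_module_free_module) (rule R.ring_axioms)
  have supp: "finite {i. f i \<noteq> \<zero>}" "{i. f i \<noteq> \<zero>} \<subseteq> I" "\<And>i. f i \<in> carrier R" if "f \<in> carrier ?F" for f
    using that by (auto simp: free_module_simps)
  have closed: "?L f \<in> carrier M" if "f \<in> carrier ?F" for f
    unfolding linear_extension_def
    by (rule M.finsum_closed) (use supp[OF that] \<phi> smult_closed in \<open>auto simp: Pi_def\<close>)
  have add: "?L (f \<oplus>\<^bsub>?F\<^esub> g) = ?L f \<oplus>\<^bsub>M\<^esub> ?L g" if fg: "f \<in> carrier ?F" "g \<in> carrier ?F" for f g
  proof -
    let ?S = "{i. f i \<noteq> \<zero>} \<union> {i. g i \<noteq> \<zero>}"
    note S = supp[OF fg(1)] supp[OF fg(2)]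
    have fS: "finite ?S" "?S \<subseteq> I" using S by auto
    have mem: "f i \<odot>\<^bsub>M\<^esub> \<phi> i \<in> carrier M" "g i \<odot>\<^bsub>M\<^esub> \<phi> i \<in> carrier M" if "i \<in> ?S" for i
      using that S \<phi> fS by (auto intro!: smult_closed simp: Pi_def subset_iff)
    have "?L (f \<oplus>\<^bsub>?F\<^esub> g) = (\<Oplus>\<^bsub>M\<^esub>i\<in>?S. (f i \<oplus> g i) \<odot>\<^bsub>M\<^esub> \<phi> i)"
    proof -
      have "{i. (f \<oplus>\<^bsub>?F\<^esub> g) i \<noteq> \<zero>} \<subseteq> ?S"
        by (auto simp: free_module_simps)
      from linear_extension_support[OF \<phi> F.M.a_closed[OF fg] fS this]
      show ?thesis by (simp add: free_module_simps)
    qed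
    also have "\<dots> = (\<Oplus>\<^bsub>M\<^esub>i\<in>?S. f i \<odot>\<^bsub>M\<^esub> \<phi> i \<oplus>\<^bsub>M\<^esub> g i \<odot>\<^bsub>M\<^esub> \<phi> i)"
      by (rule M.finsum_cong') (use mem S \<phi> fS in \<open>auto intro!: smult_l_distr simp: Pi_def subset_iff\<close>)
    also have "\<dots> = (\<Oplus>\<^bsub>M\<^esub>i\<in>?S. f i \<odot>\<^bsub>M\<^esub> \<phi> i) \<oplus>\<^bsub>M\<^esub> (\<Oplus>\<^bsub>M\<^esub>i\<in>?S. g i \<odot>\<^bsub>M\<^esub> \<phi> i)"
      by (rule M.finsum_addf) (use mem in auto)
    also have "\<dots> = ?L f \<oplus>\<^bsub>M\<^esub> ?L g"
      using linear_extension_support[OF \<phi> fg(1) fS] linear_extension_support[OF \<phi> fg(2) fS] by auto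
    finally show ?thesis .
  qed
  have smult: "?L (a \<odot>\<^bsub>?F\<^esub> f) = a \<odot>\<^bsub>M\<^esub> ?L f" if a: "a \<in> carrier R" and f: "f \<in> carrier ?F" for a f
  proof -
    let ?S = "{i. f i \<noteq> \<zero>}"
    note S = supp[OF f]
    have mem: "f i \<odot>\<^bsub>M\<^esub> \<phi> i \<in> carrier M" if "i \<in> ?S" for i
      using that S \<phi> by (auto intro!: smult_closed simp: Pi_def subset_iff)
    have "?L (a \<odot>\<^bsub>?F\<^esub> f) = (\<Oplus>\<^bsub>M\<^esub>i\<in>?S. (a \<otimes> f i) \<odot>\<^bsub>M\<^esub> \<phi> i)"
    proof -
      have "{i. (a \<odot>\<^bsub>?F\<^esub> f) i \<noteq> \<zero>} \<subseteq> ?S"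
        using a by (auto simp: free_module_simps)
      from linear_extension_support[OF \<phi> F.smult_closed[OF a f] S(1,2) this]
      show ?thesis by (simp add: free_module_simps)
    qed
    also have "\<dots> = (\<Oplus>\<^bsub>M\<^esub>i\<in>?S. a \<odot>\<^bsub>M\<^esub> (f i \<odot>\<^bsub>M\<^esub> \<phi> i))"
      by (rule M.finsum_cong') (use mem a S \<phi> in \<open>auto intro!: smult_assoc1 smult_closed simp: Pi_def subset_iff\<close>)
    also have "\<dots> = a \<odot>\<^bsub>M\<^esub> ?L f"
      unfolding linear_extension_def by (rule finsum_smult[symmetric]) (use S a mem in auto)
    finally show ?thesis .
  qed
  show ?thesis unfolding module_hom_def using closed add smult by auto
qed

lemma linear_extension_basis:
  assumes "\<phi> \<in> I \<rightarrow> carrier M" "i \<in> I"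
  shows "linear_extension R M \<phi> (free_basis R i) = \<phi> i"
proof -
  have "linear_extension R M \<phi> (free_basis R i) = (\<Oplus>\<^bsub>M\<^esub>j\<in>{i}. free_basis R i j \<odot>\<^bsub>M\<^esub> \<phi> j)"
    by (rule linear_extension_support[OF assms(1) free_basis_closed[OF R.ring_axioms assms(2)]])
      (use assms in \<open>auto simp: free_basis_def\<close>)
  also have "\<dots> = \<phi> i"
    using assms by (simp add: free_basis_def Pi_def smult_one)
  finally show ?thesis .
qed

end

lemma module_hom_abelian:
  assumes "left_module R M" "left_module R N" "h \<in> module_hom R M N"
  shows "abelian_group_hom M N h"
proof -
  interpret M: left_module R M by fact
  interpret N: left_module R N by fact
  show ?thesis
    by (rule abelian_group_homI)
      (use assms(3) in \<open>auto intro!: M.M.abelian_group_axioms N.M.abelian_group_axioms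
          group_hom.intro group_hom_axioms.intro homI M.M.add.is_group N.M.add.is_group
          simp: module_hom_def\<close>)
qed

lemma module_hom_kernel_submodule:
  assumes "left_module R M" "left_module R N" "h \<in> module_hom R M N"
  shows "submodule (a_kernel M N h) R M"
proof -
  interpret M: left_module R M by fact
  interpret N: left_module R N by fact
  interpret h: abelian_group_hom M N h by (rule module_hom_abelian[OF assms])
  show ?thesis
  proof (intro submodule.intro submodule_axioms.intro)
    show "subgroup (a_kernel M N h) (add_monoid M)"
      using h.additive_subgroup_a_kernel by (simp add: additive_subgroup_def)
  next
    fix a x assume "a \<in> carrier R" "x \<in> a_kernel M N h"
    then show "a \<odot>\<^bsub>M\<^esub> x \<in> a_kernel M N h"
      using assms(3) M.smult_closed N.smult_zero_r
      by (auto simp: a_kernel_def' module_hom_def)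
  qed
qed


lemma module_span_submodule:
  assumes "left_module R M" "S \<subseteq> carrier M"
  shows "submodule (module_span R M S) R M"
proof -
  interpret M: left_module R M by fact
  let ?H = "{H. submodule H R M \<and> S \<subseteq> H}"
  have "submodule (carrier M) R M"
    by (intro submodule.intro submodule_axioms.intro)
      (use M.smult_closed M.add.subgroup_self in auto)
  then have ne: "?H \<noteq> {}" using assms(2) by auto
  show ?thesis
    unfolding module_span_def
  proof (intro submodule.intro submodule_axioms.intro)
    show "subgroup (\<Inter> ?H) (add_monoid M)"
      by (rule M.add.subgroups_Inter) (use ne in \<open>auto dest: submodule.axioms(1)\<close>)
    show "a \<odot>\<^bsub>M\<^esub> x \<in> \<Inter> ?H" if "a \<in> carrier R" "x \<in> \<Inter> ?H" for a x
      using that by (auto intro: submodule.smult_closed)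
  qed
qed

locale bilinear_map = K?: cring K + M: left_module K M + N: left_module K N + P: left_module K P
  for K :: "('k, 'r) ring_scheme" (structure) and M :: "('k, 'b, 'm) module_scheme"
    and N :: "('k, 'c, 'n) module_scheme" and P :: "('k, 'p, 'q) module_scheme" +
  fixes \<beta> :: "'b \<Rightarrow> 'c \<Rightarrow> 'p"
  assumes closed: "\<lbrakk>x \<in> carrier M; y \<in> carrier N\<rbrakk> \<Longrightarrow> \<beta> x y \<in> carrier P"
    and add_left: "\<lbrakk>x \<in> carrier M; x' \<in> carrier M; y \<in> carrier N\<rbrakk> \<Longrightarrow>
      \<beta> (x \<oplus>\<^bsub>M\<^esub> x') y = \<beta> x y \<oplus>\<^bsub>P\<^esub> \<beta> x' y"
    and add_right: "\<lbrakk>x \<in> carrier M; y \<in> carrier N; y' \<in> carrier N\<rbrakk> \<Longrightarrow>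
      \<beta> x (y \<oplus>\<^bsub>N\<^esub> y') = \<beta> x y \<oplus>\<^bsub>P\<^esub> \<beta> x y'"
    and smult_left: "\<lbrakk>r \<in> carrier K; x \<in> carrier M; y \<in> carrier N\<rbrakk> \<Longrightarrow>
      \<beta> (r \<odot>\<^bsub>M\<^esub> x) y = r \<odot>\<^bsub>P\<^esub> \<beta> x y"
    and smult_right: "\<lbrakk>r \<in> carrier K; x \<in> carrier M; y \<in> carrier N\<rbrakk> \<Longrightarrow>
      \<beta> x (r \<odot>\<^bsub>N\<^esub> y) = r \<odot>\<^bsub>P\<^esub> \<beta> x y"
begin

abbreviation "F \<equiv> free_module K (carrier M \<times> carrier N)"
abbreviation "T \<equiv> tensor_kernel K M N"
abbreviation "L \<equiv> linear_extension K P (\<lambda>(x, y). \<beta> x y)"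

sublocale F: left_module K F
  by (rule left_module_free_module) (rule K.ring_axioms)

lemma L_hom: "L \<in> module_hom K F P"
  by (rule P.linear_extension_hom) (auto simp: closed)

lemma L_basis: "\<lbrakk>x \<in> carrier M; y \<in> carrier N\<rbrakk> \<Longrightarrow> L (free_basis K (x, y)) = \<beta> x y"
  using P.linear_extension_basis[of "\<lambda>(x, y). \<beta> x y" "carrier M \<times> carrier N" "(x, y)"]
  by (simp add: closed Pi_def)

sublocale L: abelian_group_hom F P L
  by (rule module_hom_abelian[OF F.left_module_axioms P.left_module_axioms L_hom])

lemma L_smult: "\<lbrakk>r \<in> carrier K; f \<in> carrier F\<rbrakk> \<Longrightarrow> L (r \<odot>\<^bsub>F\<^esub> f) = r \<odot>\<^bsub>P\<^esub> L f"
  using L_hom by (auto simp: module_hom_def)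

lemma basis_closed [simp]:
  "\<lbrakk>x \<in> carrier M; y \<in> carrier N\<rbrakk> \<Longrightarrow> free_basis K (x, y) \<in> carrier F"
  by (rule free_basis_closed[OF K.ring_axioms]) simp

lemma L_diff: "\<lbrakk>f \<in> carrier F; g \<in> carrier F; L f = L g\<rbrakk> \<Longrightarrow> f \<ominus>\<^bsub>F\<^esub> g \<in> a_kernel F P L"
  by (simp add: a_kernel_def' a_minus_def P.M.r_neg)

lemma tensor_relations_kernel: "tensor_relations K M N \<subseteq> a_kernel F P L"
  unfolding tensor_relations_def Let_def
  by (auto intro!: L_diff
      simp: F.smult_closed M.smult_closed N.smult_closed L_basis L_smult add_left add_right smult_left smult_right)

lemma T_kernel: "T \<subseteq> a_kernel F P L"
  unfolding tensor_kernel_def module_span_def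
  using tensor_relations_kernel
    module_hom_kernel_submodule[OF F.left_module_axioms P.left_module_axioms L_hom] by blast

lemma T_submodule: "submodule T K F"
  unfolding tensor_kernel_def
  using module_span_submodule[OF F.left_module_axioms] tensor_relations_kernel
  by (auto simp: a_kernel_def' subset_iff)

sublocale T: abelian_subgroup T F
  by (rule abelian_subgroupI3)
    (use T_submodule in \<open>auto intro: additive_subgroup.intro submodule.axioms(1) F.M.abelian_group_axioms\<close>)

lemma L_coset: assumes "f \<in> carrier F" shows "L ` (T +>\<^bsub>F\<^esub> f) = {L f}"
proof -
  have "L x = L f" if "x \<in> T +>\<^bsub>F\<^esub> f" for x
  proof -
    from that obtain t where t: "t \<in> T" "x = t \<oplus>\<^bsub>F\<^esub> f"
      by (auto simp: a_r_coset_def')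
    then have "t \<in> carrier F" "L t = \<zero>\<^bsub>P\<^esub>"
      using T_kernel by (auto simp: a_kernel_def')
    then show ?thesis using t assms by simp
  qed
  moreover have "f \<in> T +>\<^bsub>F\<^esub> f"
    by (rule T.a_rcos_self) fact
  ultimately show ?thesis by blast
qed

lemma tensor_lift_coset:
  "f \<in> carrier F \<Longrightarrow> tensor_lift K P \<beta> (T +>\<^bsub>F\<^esub> f) = L f"
  by (simp add: tensor_lift_def L_coset)

lemma tensor_lift_pure_tensor:
  "\<lbrakk>x \<in> carrier M; y \<in> carrier N\<rbrakk> \<Longrightarrow> tensor_lift K P \<beta> (pure_tensor K M N x y) = \<beta> x y"
  by (simp add: pure_tensor_def tensor_lift_coset L_basis)

lemma tensor_carrier: "carrier (tensor_product K M N) = (\<lambda>f. T +>\<^bsub>F\<^esub> f) ` carrier F"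
  by (auto simp: tensor_product_def quotient_module_def A_RCOSETS_def' a_r_coset_def')

lemma tensor_add:
  "\<lbrakk>f \<in> carrier F; g \<in> carrier F\<rbrakk> \<Longrightarrow>
    (T +>\<^bsub>F\<^esub> f) \<oplus>\<^bsub>tensor_product K M N\<^esub> (T +>\<^bsub>F\<^esub> g) = T +>\<^bsub>F\<^esub> (f \<oplus>\<^bsub>F\<^esub> g)"
  by (simp add: tensor_product_def quotient_module_def T.a_rcos_sum)

lemma tensor_smult:
  assumes r: "r \<in> carrier K" and f: "f \<in> carrier F"
  shows "r \<odot>\<^bsub>tensor_product K M N\<^esub> (T +>\<^bsub>F\<^esub> f) = T +>\<^bsub>F\<^esub> (r \<odot>\<^bsub>F\<^esub> f)"
proof -
  have "T +>\<^bsub>F\<^esub> (r \<odot>\<^bsub>F\<^esub> x) = T +>\<^bsub>F\<^esub> (r \<odot>\<^bsub>F\<^esub> f)" if "x \<in> T +>\<^bsub>F\<^esub> f" for x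
  proof -
    from that obtain t where t: "t \<in> T" "x = t \<oplus>\<^bsub>F\<^esub> f"
      by (auto simp: a_r_coset_def')
    have "t \<in> carrier F" using t T.a_subset by auto
    then have "r \<odot>\<^bsub>F\<^esub> x = r \<odot>\<^bsub>F\<^esub> t \<oplus>\<^bsub>F\<^esub> r \<odot>\<^bsub>F\<^esub> f"
      using t r f by (simp add: F.smult_r_distr)
    moreover have "r \<odot>\<^bsub>F\<^esub> t \<in> T"
      using submodule.smult_closed[OF T_submodule r t(1)] .
    ultimately have "r \<odot>\<^bsub>F\<^esub> x \<in> T +>\<^bsub>F\<^esub> (r \<odot>\<^bsub>F\<^esub> f)"
      by (auto simp: a_r_coset_def')
    then show ?thesis
      using T.a_repr_independence'[OF _ F.smult_closed[OF r f]] by simp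
  qed
  moreover have "f \<in> T +>\<^bsub>F\<^esub> f" using f by (rule T.a_rcos_self)
  ultimately have "(\<Union>x \<in> T +>\<^bsub>F\<^esub> f. T +>\<^bsub>F\<^esub> (r \<odot>\<^bsub>F\<^esub> x)) = T +>\<^bsub>F\<^esub> (r \<odot>\<^bsub>F\<^esub> f)"
    by blast
  then show ?thesis
    by (simp only: tensor_product_def quotient_module_def module.simps)
qed

lemma tensor_lift_hom: "tensor_lift K P \<beta> \<in> module_hom K (tensor_product K M N) P"
proof -
  let ?h = "tensor_lift K P \<beta>" and ?TP = "tensor_product K M N"
  have rep: "\<exists>f \<in> carrier F. X = T +>\<^bsub>F\<^esub> f" if "X \<in> carrier ?TP" for X
    using that unfolding tensor_carrier by blast
  have "?h X \<in> carrier P" if X: "X \<in> carrier ?TP" for X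
    using rep[OF X] tensor_lift_coset L.hom_closed by metis
  moreover have "?h (X \<oplus>\<^bsub>?TP\<^esub> Y) = ?h X \<oplus>\<^bsub>P\<^esub> ?h Y"
    if X: "X \<in> carrier ?TP" and Y: "Y \<in> carrier ?TP" for X Y
    using rep[OF X] rep[OF Y] tensor_add tensor_lift_coset L.hom_add F.M.a_closed by metis
  moreover have "?h (r \<odot>\<^bsub>?TP\<^esub> X) = r \<odot>\<^bsub>P\<^esub> ?h X"
    if r: "r \<in> carrier K" and X: "X \<in> carrier ?TP" for r X
    using rep[OF X] r tensor_smult tensor_lift_coset L_smult F.smult_closed by metis
  ultimately show ?thesis
    unfolding module_hom_def by blast
qed

end

lemma abelian_group_cong:
  assumes "abelian_group G" "carrier H = carrier G" "zero H = zero G" "add H = add G"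
  shows "abelian_group H"
proof -
  interpret G: abelian_group G by fact
  show ?thesis
  proof (rule abelian_groupI)
    show "\<exists>y\<in>carrier H. y \<oplus>\<^bsub>H\<^esub> x = \<zero>\<^bsub>H\<^esub>" if "x \<in> carrier H" for x
      by (rule bexI[of _ "\<ominus>\<^bsub>G\<^esub> x"]) (use that assms in \<open>auto simp: G.l_neg\<close>)
  qed (auto simp: assms G.a_ac)
qed

lemma ring_opposite_ring:
  assumes "ring R" shows "ring (opposite_ring R)"
proof -
  interpret R: ring R by fact
  have "abelian_group (opposite_ring R)"
    by (rule abelian_group_cong[OF R.abelian_group_axioms]) (simp_all add: opposite_ring_def)
  moreover have "monoid (opposite_ring R)"
    by (rule monoidI) (simp_all add: opposite_ring_def R.m_assoc)
  ultimately show ?thesis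
    by (rule ringI) (simp_all add: opposite_ring_def R.l_distr R.r_distr)
qed

context unital_algebra
begin

lemma left_module_homotope: "left_module K (homotope A \<Delta>)"
proof -
  have "abelian_group (homotope A \<Delta>)"
    by (rule abelian_group_cong[OF M.abelian_group_axioms]) (simp_all add: homotope_def)
  then show ?thesis
    by (intro left_module.intro left_module_axioms.intro R.ring_axioms)
      (auto simp: homotope_def smult_l_distr smult_r_distr smult_assoc1)
qed

lemma bilinear_map_homotope:
  assumes "\<Delta> \<in> carrier A"
  shows "bilinear_map K (homotope A \<Delta>) (homotope A \<Delta>) (homotope A \<Delta>) (mult (homotope A \<Delta>))"
  using assms
  by (intro bilinear_map.intro bilinear_map_axioms.intro left_module_homotope R.is_cring)
    (auto simp: homotope_def A.l_distr A.r_distr smult_assoc_l smult_assoc_r)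

lemma ring_adjoin_unit:
  assumes \<Delta>: "\<Delta> \<in> carrier A"
  shows "ring (adjoin_unit K (homotope A \<Delta>))"
proof -
  let ?B = "adjoin_unit K (homotope A \<Delta>)"
  have "abelian_group ?B"
  proof (rule abelian_groupI)
    show "\<exists>y\<in>carrier ?B. y \<oplus>\<^bsub>?B\<^esub> x = \<zero>\<^bsub>?B\<^esub>" if "x \<in> carrier ?B" for x
      by (rule bexI[of _ "(\<ominus>\<^bsub>K\<^esub> fst x, \<ominus>\<^bsub>A\<^esub> snd x)"])
        (use that in \<open>auto simp: adjoin_unit_def homotope_def R.l_neg M.l_neg\<close>)
  qed (auto simp: adjoin_unit_def homotope_def R.a_ac M.a_ac)
  moreover have "monoid ?B"
    by (rule monoidI)
      (use \<Delta> in \<open>auto simp: adjoin_unit_def homotope_def R.m_ac A.m_assoc A.l_distr A.r_distr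
        smult_assoc_l smult_assoc_r smult_l_distr smult_r_distr smult_assoc1[symmetric] M.a_ac\<close>)
  ultimately show ?thesis
    by (rule ringI)
      (use \<Delta> in \<open>auto simp: adjoin_unit_def homotope_def R.l_distr R.r_distr A.l_distr A.r_distr
        smult_l_distr smult_r_distr M.a_ac\<close>)
qed

lemma ideal_augmentation_ideal:
  assumes \<Delta>: "\<Delta> \<in> carrier A"
  shows "ideal (augmentation_ideal K (homotope A \<Delta>)) (adjoin_unit K (homotope A \<Delta>))"
proof -
  let ?B = "adjoin_unit K (homotope A \<Delta>)"
  interpret B: ring ?B by (rule ring_adjoin_unit) fact
  have neg: "\<ominus>\<^bsub>?B\<^esub> (\<zero>\<^bsub>K\<^esub>, x) = (\<zero>\<^bsub>K\<^esub>, \<ominus>\<^bsub>A\<^esub> x)" if "x \<in> carrier A" for x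
    by (rule B.minus_equality)
      (use that in \<open>auto simp: adjoin_unit_def homotope_def M.l_neg\<close>)
  show ?thesis
  proof (rule idealI[OF B.ring_axioms])
    show "subgroup (augmentation_ideal K (homotope A \<Delta>)) (add_monoid ?B)"
      by (rule B.add.subgroupI)
        (use neg in \<open>auto simp: augmentation_ideal_def a_inv_def[symmetric] homotope_def adjoin_unit_def\<close>)
  qed (use \<Delta> in \<open>auto simp: augmentation_ideal_def homotope_def adjoin_unit_def\<close>)
qed

end

lemma left_module_ideal_module:
  assumes "ideal J R" shows "left_module R (ideal_module R J)"
proof -
  interpret J: ideal J R by fact
  have "abelian_group (ideal_module R J)"
  proof (rule abelian_groupI)
    show "\<exists>y\<in>carrier (ideal_module R J). y \<oplus>\<^bsub>ideal_module R J\<^esub> x = \<zero>\<^bsub>ideal_module R J\<^esub>"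
      if "x \<in> carrier (ideal_module R J)" for x
      by (rule bexI[of _ "\<ominus>\<^bsub>R\<^esub> x"])
        (use that in \<open>auto simp: ideal_module_def J.l_neg J.Icarr\<close>)
  qed (auto simp: ideal_module_def J.Icarr J.a_ac)
  then show ?thesis
    by (intro left_module.intro left_module_axioms.intro J.ring_axioms)
      (auto simp: ideal_module_def J.Icarr J.I_l_closed J.l_distr J.r_distr J.m_assoc)
qed

lemma ideal_opposite_ring:
  assumes "ideal J R" shows "ideal J (opposite_ring R)"
proof -
  interpret J: ideal J R by fact
  show ?thesis
    by (rule idealI[OF ring_opposite_ring[OF J.ring_axioms]])
      (use J.a_subgroup in \<open>auto simp: opposite_ring_def J.I_l_closed J.I_r_closed\<close>)
qed

end

theory Submission
  imports Defs "HOL-Algebra.QuotRing"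
begin

text \<open>
  Since \<open>d (a c \<Delta> d b) c = (d a c) \<Delta> (d b c)\<close>, the map \<open>x \<mapsto> d x c\<close> is an isomorphism from the
  homotope at \<open>c \<Delta> d\<close> to the homotope at \<open>\<Delta>\<close>.  It extends to an isomorphism of the unitizations
  carrying one augmentation ideal onto the other, and both conditions in the definition of a
  well-tempered element are invariant under such isomorphisms.
\<close>

text \<open>The unitizations of the two homotopes are different rings, so their augmentation ideals
  can only be compared by maps that are linear along \<open>\<theta>\<close>. That
  \<open>\<theta>\<close> is a ring isomorphism is left to the context in which this set is
  used.\<close>

definition semilinear_iso ::
  "('a, 'r) ring_scheme \<Rightarrow> ('c, 's) ring_scheme \<Rightarrow> ('a \<Rightarrow> 'c) \<Rightarrow>
    ('a, 'b, 'm) module_scheme \<Rightarrow> ('c, 'd, 'n) module_scheme \<Rightarrow> ('b \<Rightarrow> 'd) set"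
  where "semilinear_iso R S \<theta> M N =
    {g. bij_betw g (carrier M) (carrier N) \<and>
      (\<forall>x \<in> carrier M. \<forall>y \<in> carrier M. g (x \<oplus>\<^bsub>M\<^esub> y) = g x \<oplus>\<^bsub>N\<^esub> g y) \<and>
      (\<forall>a \<in> carrier R. \<forall>x \<in> carrier M. g (a \<odot>\<^bsub>M\<^esub> x) = \<theta> a \<odot>\<^bsub>N\<^esub> g x)}"

section \<open>Closure properties of submodules\<close>

lemma (in left_module) submoduleI:
  assumes "H \<subseteq> carrier M" "\<zero>\<^bsub>M\<^esub> \<in> H"
    and "\<And>x y. \<lbrakk>x \<in> H; y \<in> H\<rbrakk> \<Longrightarrow> x \<oplus>\<^bsub>M\<^esub> y \<in> H"
    and sm: "\<And>a x. \<lbrakk>a \<in> carrier R; x \<in> H\<rbrakk> \<Longrightarrow> a \<odot>\<^bsub>M\<^esub> x \<in> H"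
  shows "submodule H R M"
proof (intro submodule.intro submodule_axioms.intro sm)
  \<comment> \<open>Negatives come for free: they are the multiples by the scalar -1.\<close>
  have "\<ominus>\<^bsub>M\<^esub> x \<in> H" if x: "x \<in> H" for x
  proof -
    have xM: "x \<in> carrier M" using x assms(1) by blast
    have "(\<ominus> \<one>) \<odot>\<^bsub>M\<^esub> x \<oplus>\<^bsub>M\<^esub> x = (\<ominus> \<one> \<oplus> \<one>) \<odot>\<^bsub>M\<^esub> x"
      using xM by (subst smult_l_distr) (simp_all add: smult_one)
    also have "\<dots> = \<zero>\<^bsub>M\<^esub>"
      using xM by (simp add: R.l_neg smult_zero_l)
    finally have "\<ominus>\<^bsub>M\<^esub> x = (\<ominus> \<one>) \<odot>\<^bsub>M\<^esub> x"
      using xM by (intro M.minus_equality) (simp_all add: smult_closed)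
    then show ?thesis
      using x sm by simp
  qed
  then show "subgroup H (add_monoid M)"
    by (intro M.add.subgroupI) (use assms in \<open>auto simp: a_inv_def\<close>)
qed

text \<open>Every value is a finite linear combination of the \<open>\<phi> i\<close>. This allows
  the image of a linear extension to be bounded by checking generators only.\<close>

lemma (in left_module) linear_extension_in_submodule:
  assumes "submodule H R M" "\<phi> \<in> I \<rightarrow> H" "f \<in> carrier (free_module R I)"
  shows "linear_extension R M \<phi> f \<in> H"
proof -
  interpret H: submodule H R M by fact
  \<comment> \<open>The family \<open>f\<close> stays fixed while \<open>S\<close> varies over
    finite subsets of \<open>I\<close>, which makes the induction possible; the support of
    \<open>f\<close> is the instance used.\<close>
  have "(\<Oplus>\<^bsub>M\<^esub>i\<in>S. f i \<odot>\<^bsub>M\<^esub> \<phi> i) \<in> H" if "finite S" "S \<subseteq> I" for S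
    using that
  proof (induction S rule: finite_induct)
    case empty
    then show ?case using H.one_closed by simp
  next
    case (insert i S)
    have mem: "f j \<odot>\<^bsub>M\<^esub> \<phi> j \<in> H" if "j \<in> I" for j
      using that assms(2,3) by (auto simp: free_module_simps intro: H.smult_closed)
    then have "f j \<odot>\<^bsub>M\<^esub> \<phi> j \<in> carrier M" if "j \<in> I" for j
      using that H.subset by auto
    then show ?case
      using insert mem H.m_closed by (subst M.finsum_insert) auto
  qed
  then show ?thesis
    using assms(3) unfolding linear_extension_def by (auto simp: free_module_simps)
qed

section \<open>Transport of modules along a ring isomorphism\<close>

context
  fixes R :: "('a, 'r) ring_scheme" and S :: "('c, 's) ring_scheme" and \<theta> :: "'a \<Rightarrow> 'c"
  assumes R: "ring R" and S: "ring S" and \<theta>: "\<theta> \<in> ring_iso R S"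
begin

interpretation R: ring R by (rule R)
interpretation S: ring S by (rule S)

lemma ring_iso_bij: "bij_betw \<theta> (carrier R) (carrier S)"
  using \<theta> by (simp add: ring_iso_def)

interpretation \<theta>: ring_hom_ring R S \<theta>
  by (rule ring_hom_ringI2[OF R S]) (use \<theta> in \<open>simp add: ring_iso_def\<close>)

text \<open>The isomorphism and its inverse act coordinatewise, so the index set is kept. Both fix
  zero, hence supports stay finite and inside \<open>I\<close>.\<close>

lemma semilinear_iso_free_module:
  "(\<lambda>f. \<theta> \<circ> f) \<in> semilinear_iso R S \<theta> (free_module R I) (free_module S I)"
proof -
  let ?F = "free_module R I" and ?G = "free_module S I" and ?\<rho> = "inv_into (carrier R) \<theta>"
  have \<rho>: "?\<rho> y \<in> carrier R" "\<theta> (?\<rho> y) = y" if "y \<in> carrier S" for y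
    using ring_iso_bij that
    by (auto simp: bij_betw_def intro: inv_into_into f_inv_into_f)
  have \<rho>\<theta>: "?\<rho> (\<theta> x) = x" if "x \<in> carrier R" for x
    using ring_iso_bij that by (auto simp: bij_betw_def)
  have \<rho>0: "?\<rho> \<zero>\<^bsub>S\<^esub> = \<zero>\<^bsub>R\<^esub>"
    using \<rho>\<theta>[of "\<zero>\<^bsub>R\<^esub>"] by simp
  have "bij_betw (\<lambda>f. \<theta> \<circ> f) (carrier ?F) (carrier ?G)"
  proof (rule bij_betw_byWitness[where f' = "\<lambda>g. ?\<rho> \<circ> g"])
    show "\<forall>f\<in>carrier ?F. ?\<rho> \<circ> (\<theta> \<circ> f) = f" "\<forall>g\<in>carrier ?G. \<theta> \<circ> (?\<rho> \<circ> g) = g"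
      by (auto simp: free_module_simps \<rho> \<rho>\<theta>)
    show "(\<lambda>f. \<theta> \<circ> f) ` carrier ?F \<subseteq> carrier ?G"
      by (auto simp: free_module_simps elim!: rev_finite_subset)
    show "(\<lambda>g. ?\<rho> \<circ> g) ` carrier ?G \<subseteq> carrier ?F"
      by (auto simp: free_module_simps \<rho> \<rho>0 elim!: rev_finite_subset)
  qed
  then show ?thesis
    by (auto simp: semilinear_iso_def free_module_simps)
qed

context
  fixes M :: "('a, 'b, 'm) module_scheme" and N :: "('c, 'd, 'n) module_scheme" and g :: "'b \<Rightarrow> 'd"
  assumes M: "left_module R M" and N: "left_module S N" and g: "g \<in> semilinear_iso R S \<theta> M N"
begin

interpretation M: left_module R M by (rule M)
interpretation N: left_module S N by (rule N)

lemma semilinear_iso_simps: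
  "bij_betw g (carrier M) (carrier N)"
  "x \<in> carrier M \<Longrightarrow> g x \<in> carrier N"
  "\<lbrakk>x \<in> carrier M; y \<in> carrier M\<rbrakk> \<Longrightarrow> g (x \<oplus>\<^bsub>M\<^esub> y) = g x \<oplus>\<^bsub>N\<^esub> g y"
  "\<lbrakk>a \<in> carrier R; x \<in> carrier M\<rbrakk> \<Longrightarrow> g (a \<odot>\<^bsub>M\<^esub> x) = \<theta> a \<odot>\<^bsub>N\<^esub> g x"
  using g by (auto simp: semilinear_iso_def bij_betw_def)

lemma semilinear_iso_zero: "g \<zero>\<^bsub>M\<^esub> = \<zero>\<^bsub>N\<^esub>"
proof -
  \<comment> \<open>Zero is written as a scalar multiple, so that semilinearity and
    \<open>\<theta> 0 = 0\<close> decide its image.\<close>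
  have "g (\<zero>\<^bsub>R\<^esub> \<odot>\<^bsub>M\<^esub> \<zero>\<^bsub>M\<^esub>) = \<theta> \<zero>\<^bsub>R\<^esub> \<odot>\<^bsub>N\<^esub> g \<zero>\<^bsub>M\<^esub>"
    by (rule semilinear_iso_simps(4)) auto
  then show ?thesis
    by (simp add: M.smult_zero_l N.smult_zero_l semilinear_iso_simps(2))
qed

lemma semilinear_iso_submodule:
  assumes "submodule H R M"
  shows "submodule (g ` H) S N"
proof -
  interpret H: submodule H R M by fact
  have HM: "x \<in> carrier M" if "x \<in> H" for x using that H.subset by auto
  show ?thesis
  proof (rule N.submoduleI)
    show "g ` H \<subseteq> carrier N" using HM semilinear_iso_simps(2) by auto
    show "\<zero>\<^bsub>N\<^esub> \<in> g ` H"
      using H.one_closed semilinear_iso_zero by (intro image_eqI[of _ _ "\<zero>\<^bsub>M\<^esub>"]) simp_all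
    show "x \<oplus>\<^bsub>N\<^esub> y \<in> g ` H" if xy: "x \<in> g ` H" "y \<in> g ` H" for x y
    proof -
      obtain u v where "u \<in> H" "v \<in> H" "x = g u" "y = g v"
        using xy by blast
      then show ?thesis
        using HM semilinear_iso_simps(3)[of u v] H.m_closed[of u v]
        by (intro image_eqI[of _ _ "u \<oplus>\<^bsub>M\<^esub> v"]) simp_all
    qed
    show "a \<odot>\<^bsub>N\<^esub> x \<in> g ` H" if ax: "a \<in> carrier S" "x \<in> g ` H" for a x
    proof -
      \<comment> \<open>Surjectivity of \<open>\<theta>\<close> turns each scalar of
        \<open>S\<close> into one from \<open>R\<close>, under which \<open>H\<close> is
        closed.\<close>
      have "\<theta> ` carrier R = carrier S"
        using ring_iso_bij by (simp add: bij_betw_def)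
      then obtain b y where "b \<in> carrier R" "a = \<theta> b" "y \<in> H" "x = g y"
        using ax by blast
      then show ?thesis
        using HM semilinear_iso_simps(4)[of b y] H.smult_closed[of b y]
        by (intro image_eqI[of _ _ "b \<odot>\<^bsub>M\<^esub> y"]) simp_all
    qed
  qed
qed

lemma semilinear_iso_set_add:
  assumes "H \<subseteq> carrier M" "H' \<subseteq> carrier M"
  shows "g ` (H <+>\<^bsub>M\<^esub> H') = g ` H <+>\<^bsub>N\<^esub> g ` H'"
proof -
  have "g (x \<oplus>\<^bsub>M\<^esub> y) = g x \<oplus>\<^bsub>N\<^esub> g y" if "x \<in> H" "y \<in> H'" for x y
    using that assms by (auto intro: semilinear_iso_simps(3))
  then show ?thesis
    unfolding set_add_def' image_UN by simp
qed

end

text \<open>A decomposition of the free module over \<open>R\<close> is carried by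
  \<open>\<theta>\<close> to one over \<open>S\<close>, and \<open>P\<close> embedded as a summand
  becomes \<open>Q\<close> embedded as a summand. \<open>P\<close> and \<open>Q\<close> share an
  element type because projectivity takes the index set there, and the same \<open>I\<close> serves
  both.\<close>

lemma is_projective_module_transfer:
  fixes P :: "('a, 'b, 'm) module_scheme" and Q :: "('c, 'b, 'n) module_scheme"
  assumes P: "is_projective_module R P" and Q: "left_module S Q"
    and g: "g \<in> semilinear_iso R S \<theta> P Q"
  shows "is_projective_module S Q"
proof -
  from P obtain I :: "'b set" and h N N' where
    N: "submodule N R (free_module R I)" "submodule N' R (free_module R I)"
    and sum: "N <+>\<^bsub>free_module R I\<^esub> N' = carrier (free_module R I)"
    and int: "N \<inter> N' = {\<zero>\<^bsub>free_module R I\<^esub>}"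
    and h: "h \<in> module_hom R P (free_module R I)" and hN: "bij_betw h (carrier P) N"
    unfolding is_projective_module_def Let_def by blast
  have lmP: "left_module R P" using P by (simp add: is_projective_module_def)
  interpret P: left_module R P by (rule lmP)
  interpret Q: left_module S Q by (rule Q)
  let ?F = "free_module R I" and ?G = "free_module S I" and ?\<Theta> = "\<lambda>f. \<theta> \<circ> f"
  note F = left_module_free_module[OF R, of I] and G = left_module_free_module[OF S, of I]
  note \<Theta> = semilinear_iso_free_module[of I]
  note \<Theta>_simps = semilinear_iso_simps[OF F G \<Theta>] and g_simps = semilinear_iso_simps[OF lmP Q g]
  have NF: "N \<subseteq> carrier ?F" "N' \<subseteq> carrier ?F"
    using N[THEN submodule.axioms(1), THEN subgroup.subset] by simp_all
  define k where "k = inv_into (carrier P) g"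
  have k: "k y \<in> carrier P" "g (k y) = y" if "y \<in> carrier Q" for y
    using g_simps(1) that
    by (auto simp: k_def bij_betw_def intro: inv_into_into f_inv_into_f)
  have kg: "k (g x) = x" if "x \<in> carrier P" for x
    using g_simps(1) that by (simp add: k_def bij_betw_def)
  \<comment> \<open>Both laws for the inverse of \<open>g\<close> come from evaluating
    \<open>k (g z) = z\<close> at a sum or a multiple. The second is stated for scalars
    \<open>\<theta> a\<close>, which avoids the inverse of \<open>\<theta>\<close>.\<close>
  have k_add: "k (x \<oplus>\<^bsub>Q\<^esub> y) = k x \<oplus>\<^bsub>P\<^esub> k y" if "x \<in> carrier Q" "y \<in> carrier Q" for x y
    using kg[of "k x \<oplus>\<^bsub>P\<^esub> k y"] that by (simp add: k g_simps(3))
  have k_smult: "k (\<theta> a \<odot>\<^bsub>Q\<^esub> y) = a \<odot>\<^bsub>P\<^esub> k y" if "a \<in> carrier R" "y \<in> carrier Q" for a y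
    using kg[of "a \<odot>\<^bsub>P\<^esub> k y"] that by (simp add: k g_simps(4) P.smult_closed)
  have bij_k: "bij_betw k (carrier Q) (carrier P)"
    unfolding k_def by (rule bij_betw_inv_into) (rule g_simps(1))
  have h_simps: "\<And>x. x \<in> carrier P \<Longrightarrow> h x \<in> carrier ?F"
    "\<And>x y. \<lbrakk>x \<in> carrier P; y \<in> carrier P\<rbrakk> \<Longrightarrow> h (x \<oplus>\<^bsub>P\<^esub> y) = h x \<oplus>\<^bsub>?F\<^esub> h y"
    "\<And>a x. \<lbrakk>a \<in> carrier R; x \<in> carrier P\<rbrakk> \<Longrightarrow> h (a \<odot>\<^bsub>P\<^esub> x) = a \<odot>\<^bsub>?F\<^esub> h x"
    using h by (auto simp: module_hom_def)
  \<comment> \<open>\<open>k\<close> is semilinear along the inverse of \<open>\<theta>\<close>,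
    \<open>h\<close> is linear over \<open>R\<close>, and composition with \<open>\<theta>\<close>
    is semilinear along \<open>\<theta>\<close>; the twists cancel, leaving a map linear over
    \<open>S\<close>.\<close>
  let ?h = "\<lambda>x. \<theta> \<circ> h (k x)"
  have smult: "?h (a \<odot>\<^bsub>Q\<^esub> x) = a \<odot>\<^bsub>?G\<^esub> ?h x" if a: "a \<in> carrier S" and x: "x \<in> carrier Q" for a x
  proof -
    obtain b where "b \<in> carrier R" "a = \<theta> b"
      using a ring_iso_bij by (auto simp: bij_betw_def)
    then show ?thesis
      using x by (simp add: k_smult k h_simps \<Theta>_simps(4))
  qed
  have "?h \<in> module_hom S Q ?G"
    unfolding module_hom_def using smult
    by (auto simp: k k_add h_simps \<Theta>_simps(3) intro!: \<Theta>_simps(2))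
  moreover have "bij_betw ?h (carrier Q) (?\<Theta> ` N)"
  proof -
    have "bij_betw ?\<Theta> N (?\<Theta> ` N)"
      by (rule bij_betw_subset[OF \<Theta>_simps(1) NF(1)]) simp
    from bij_betw_trans[OF bij_betw_trans[OF bij_k hN] this]
    show ?thesis by (simp add: comp_def)
  qed
  moreover have "?\<Theta> ` N <+>\<^bsub>?G\<^esub> ?\<Theta> ` N' = carrier ?G"
    using semilinear_iso_set_add[OF F G \<Theta> NF] sum \<Theta>_simps(1) by (simp add: bij_betw_def)
  moreover have "?\<Theta> ` N \<inter> ?\<Theta> ` N' = {\<zero>\<^bsub>?G\<^esub>}"
    using inj_on_image_Int[OF bij_betw_imp_inj_on[OF \<Theta>_simps(1)] NF] int
      semilinear_iso_zero[OF F G \<Theta>] by simp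
  moreover note N[THEN semilinear_iso_submodule[OF F G \<Theta>]]
  ultimately show ?thesis
    unfolding is_projective_module_def Let_def using Q by blast
qed


end

text \<open>Scalars act on an ideal by the ring multiplication, so multiplicativity of
  \<open>\<theta>\<close> is exactly semilinearity of its restriction to \<open>J\<close>.\<close>

lemma ideal_module_projective_transfer:
  fixes R :: "('a, 'r) ring_scheme" and S :: "('a, 's) ring_scheme"
  assumes J: "ideal J R" and J': "ideal J' S" and \<theta>: "\<theta> \<in> ring_iso R S" and im: "\<theta> ` J = J'"
    and P: "is_projective_module R (ideal_module R J)"
  shows "is_projective_module S (ideal_module S J')"
proof -
  interpret J: ideal J R by (rule J)
  interpret J': ideal J' S by (rule J')
  have "bij_betw \<theta> J J'"
    using bij_betw_subset[of \<theta> "carrier R" "carrier S" J J'] \<theta> im J.a_subset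
    by (simp add: ring_iso_def)
  then have "\<theta> \<in> semilinear_iso R S \<theta> (ideal_module R J) (ideal_module S J')"
    using \<theta> by (auto simp: semilinear_iso_def ideal_module_def ring_iso_def ring_hom_def J.Icarr)
  with is_projective_module_transfer[OF J.ring_axioms J'.ring_axioms \<theta> P] J'
  show ?thesis
    by (blast intro: left_module_ideal_module)
qed

lemma ring_iso_opposite_ring:
  "\<theta> \<in> ring_iso R S \<Longrightarrow> \<theta> \<in> ring_iso (opposite_ring R) (opposite_ring S)"
  by (auto simp: ring_iso_def ring_hom_def opposite_ring_def)

section \<open>Surjectivity of maps induced by bilinear maps\<close>

lemma (in bilinear_map) tensor_lift_surj_transfer:
  assumes "bilinear_map K M' N' P' \<beta>'"
    and p: "p \<in> carrier M \<rightarrow> carrier M'" and q: "q \<in> carrier N \<rightarrow> carrier N'"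
    and r: "r \<in> module_hom K P P'" and r_surj: "r ` carrier P = carrier P'"
    and comm: "\<And>x y. \<lbrakk>x \<in> carrier M; y \<in> carrier N\<rbrakk> \<Longrightarrow> r (\<beta> x y) = \<beta>' (p x) (q y)"
    and surj: "tensor_lift K P \<beta> ` carrier (tensor_product K M N) = carrier P"
  shows "tensor_lift K P' \<beta>' ` carrier (tensor_product K M' N') = carrier P'"
proof -
  interpret B': bilinear_map K M' N' P' \<beta>' by fact
  \<comment> \<open>Each class in the tensor product has a representative in the free module, so
    both images can be computed there, without cosets.\<close>
  have image: "tensor_lift K P \<beta> ` carrier (tensor_product K M N) = L ` carrier F"
    unfolding tensor_carrier image_image by (rule image_cong) (simp_all add: tensor_lift_coset)
  have image': "tensor_lift K P' \<beta>' ` carrier (tensor_product K M' N') = B'.L ` carrier B'.F"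
    unfolding B'.tensor_carrier image_image by (rule image_cong) (simp_all add: B'.tensor_lift_coset)
  \<comment> \<open>The preimage under \<open>r\<close> of the image to be shown full. It is a
    submodule containing every \<open>\<beta> x y\<close>, and these span \<open>P\<close> by the
    assumed surjectivity.\<close>
  let ?H = "{z \<in> carrier P. r z \<in> B'.L ` carrier B'.F}"
  have r_smult: "r (a \<odot>\<^bsub>P\<^esub> x) = a \<odot>\<^bsub>P'\<^esub> r x" if "a \<in> carrier K" "x \<in> carrier P" for a x
    using r that by (auto simp: module_hom_def)
  interpret r: abelian_group_hom P P' r
    by (rule module_hom_abelian[OF P.left_module_axioms B'.P.left_module_axioms r])
  have sub: "submodule ?H K P"
  proof (rule P.submoduleI)
    have "\<zero>\<^bsub>P'\<^esub> = B'.L \<zero>\<^bsub>B'.F\<^esub>" by simp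
    then show "\<zero>\<^bsub>P\<^esub> \<in> ?H" by (auto intro!: image_eqI)
    show "x \<oplus>\<^bsub>P\<^esub> y \<in> ?H" if xy: "x \<in> ?H" "y \<in> ?H" for x y
    proof -
      obtain f f' where "f \<in> carrier B'.F" "f' \<in> carrier B'.F" "r x = B'.L f" "r y = B'.L f'"
        using xy by auto
      then have "r (x \<oplus>\<^bsub>P\<^esub> y) = B'.L (f \<oplus>\<^bsub>B'.F\<^esub> f')" "f \<oplus>\<^bsub>B'.F\<^esub> f' \<in> carrier B'.F"
        using xy by simp_all
      then show ?thesis using xy by auto
    qed
    show "a \<odot>\<^bsub>P\<^esub> x \<in> ?H" if ax: "a \<in> carrier K" "x \<in> ?H" for a x
    proof -
      obtain f where "f \<in> carrier B'.F" "r x = B'.L f"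
        using ax by auto
      then have "r (a \<odot>\<^bsub>P\<^esub> x) = B'.L (a \<odot>\<^bsub>B'.F\<^esub> f)" "a \<odot>\<^bsub>B'.F\<^esub> f \<in> carrier B'.F"
        using ax by (simp_all add: r_smult B'.L_smult B'.F.smult_closed)
      then show ?thesis using ax by (auto simp: P.smult_closed)
    qed
  qed auto
  have "\<beta> x y \<in> ?H" if "x \<in> carrier M" "y \<in> carrier N" for x y
  proof -
    have "p x \<in> carrier M'" "q y \<in> carrier N'" using that p q by auto
    then have "r (\<beta> x y) = B'.L (free_basis K (p x, q y))"
      "free_basis K (p x, q y) \<in> carrier B'.F"
      using that by (simp_all add: comm B'.L_basis)
    then show ?thesis using that by (auto simp: closed)
  qed
  then have "L ` carrier F \<subseteq> ?H"
    by (intro image_subsetI P.linear_extension_in_submodule[OF sub, of _ "carrier M \<times> carrier N"]) auto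
  then have "carrier P \<subseteq> ?H"
    unfolding image[symmetric] surj .
  then have "r ` carrier P \<subseteq> B'.L ` carrier B'.F"
    by blast
  then show ?thesis
    unfolding image' r_surj by auto
qed

section \<open>Multiplying the homotope parameter by units\<close>

context unital_algebra
begin

text \<open>One implication suffices: since \<open>c\<close> and \<open>d\<close> are arbitrary
  units, the converse is the instance for their inverses.\<close>

lemma well_tempered_mult_units_imp:
  assumes \<Delta>: "\<Delta> \<in> carrier A" and c: "c \<in> Units A" and d: "d \<in> Units A"
    and wt: "well_tempered K A (c \<otimes>\<^bsub>A\<^esub> \<Delta> \<otimes>\<^bsub>A\<^esub> d)"
  shows "well_tempered K A \<Delta>"
proof -
  let ?\<Delta>' = "c \<otimes>\<^bsub>A\<^esub> \<Delta> \<otimes>\<^bsub>A\<^esub> d"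
  let ?C = "homotope A ?\<Delta>'" and ?D = "homotope A \<Delta>"
  let ?J = "augmentation_ideal K ?C" and ?J' = "augmentation_ideal K ?D"
  let ?R = "adjoin_unit K ?C" and ?S = "adjoin_unit K ?D"
  have cd [simp]: "c \<in> carrier A" "d \<in> carrier A" "inv\<^bsub>A\<^esub> c \<in> carrier A" "inv\<^bsub>A\<^esub> d \<in> carrier A"
    using c d by (auto intro: A.Units_closed)
  have \<Delta>': "?\<Delta>' \<in> carrier A" using \<Delta> by simp
  define \<phi> where "\<phi> x = d \<otimes>\<^bsub>A\<^esub> x \<otimes>\<^bsub>A\<^esub> c" for x
  have [simp]: "\<phi> x \<in> carrier A" if "x \<in> carrier A" for x
    using that by (simp add: \<phi>_def)
  have \<phi>_add: "\<phi> (x \<oplus>\<^bsub>A\<^esub> y) = \<phi> x \<oplus>\<^bsub>A\<^esub> \<phi> y" if "x \<in> carrier A" "y \<in> carrier A" for x y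
    using that by (simp add: \<phi>_def A.l_distr A.r_distr)
  have \<phi>_smult: "\<phi> (r \<odot>\<^bsub>A\<^esub> x) = r \<odot>\<^bsub>A\<^esub> \<phi> x" if "r \<in> carrier K" "x \<in> carrier A" for r x
    using that by (simp add: \<phi>_def smult_assoc_l smult_assoc_r)
  \<comment> \<open>Both sides reassociate to \<open>d x c \<Delta> d y c\<close>.\<close>
  have \<phi>_mult: "\<phi> (x \<otimes>\<^bsub>A\<^esub> ?\<Delta>' \<otimes>\<^bsub>A\<^esub> y) = \<phi> x \<otimes>\<^bsub>A\<^esub> \<Delta> \<otimes>\<^bsub>A\<^esub> \<phi> y"
    if "x \<in> carrier A" "y \<in> carrier A" for x y
    using that \<Delta> by (simp add: \<phi>_def A.m_assoc)
  have bij: "bij_betw \<phi> (carrier A) (carrier A)"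
  proof (rule bij_betw_byWitness[where f' = "\<lambda>y. inv\<^bsub>A\<^esub> d \<otimes>\<^bsub>A\<^esub> y \<otimes>\<^bsub>A\<^esub> inv\<^bsub>A\<^esub> c"])
    \<comment> \<open>This regrouping brings each unit next to its inverse, for both composites at
      once.\<close>
    have "u \<otimes>\<^bsub>A\<^esub> (v \<otimes>\<^bsub>A\<^esub> x \<otimes>\<^bsub>A\<^esub> w) \<otimes>\<^bsub>A\<^esub> z = (u \<otimes>\<^bsub>A\<^esub> v) \<otimes>\<^bsub>A\<^esub> x \<otimes>\<^bsub>A\<^esub> (w \<otimes>\<^bsub>A\<^esub> z)"
      if "u \<in> carrier A" "v \<in> carrier A" "w \<in> carrier A" "x \<in> carrier A" "z \<in> carrier A" for u v w x z
      using that by (simp add: A.m_assoc)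
    then show "\<forall>x\<in>carrier A. inv\<^bsub>A\<^esub> d \<otimes>\<^bsub>A\<^esub> \<phi> x \<otimes>\<^bsub>A\<^esub> inv\<^bsub>A\<^esub> c = x"
      "\<forall>y\<in>carrier A. \<phi> (inv\<^bsub>A\<^esub> d \<otimes>\<^bsub>A\<^esub> y \<otimes>\<^bsub>A\<^esub> inv\<^bsub>A\<^esub> c) = y"
      using c d by (simp_all add: \<phi>_def A.Units_l_inv A.Units_r_inv)
  qed auto
  then have \<phi>_surj: "\<phi> ` carrier A = carrier A"
    by (simp add: bij_betw_def)
  have \<phi>_hom: "\<phi> \<in> module_hom K ?C ?D"
    by (auto simp: module_hom_def homotope_def \<phi>_add \<phi>_smult)
  \<comment> \<open>The scalar component is left alone, since an extension that is linear over
    \<open>K\<close> and preserves the adjoined unit must fix the multiples of that unit.\<close>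
  define \<theta> where "\<theta> = map_prod (id :: 'a \<Rightarrow> 'a) \<phi>"
  have "bij_betw \<theta> (carrier ?R) (carrier ?S)"
    using bij_betw_map_prod[OF bij_betw_id bij, of "carrier K"]
    by (simp add: \<theta>_def adjoin_unit_def homotope_def)
  \<comment> \<open>The adjoined unit is the pair \<open>(1, 0)\<close>, so its preservation rests
    on \<open>\<phi> 0 = 0\<close>.\<close>
  moreover have "\<phi> \<zero>\<^bsub>A\<^esub> = \<zero>\<^bsub>A\<^esub>"
    by (simp add: \<phi>_def)
  ultimately have \<theta>: "\<theta> \<in> ring_iso ?R ?S"
    using \<Delta> by (auto simp: \<theta>_def ring_iso_def ring_hom_def adjoin_unit_def homotope_def
        \<phi>_add \<phi>_smult \<phi>_mult)
  have \<theta>_J: "\<theta> ` ?J = ?J'"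
    using \<phi>_surj by (force simp: \<theta>_def augmentation_ideal_def homotope_def map_prod_surj_on)
  note J = ideal_augmentation_ideal[OF \<Delta>'] and J' = ideal_augmentation_ideal[OF \<Delta>]
  have "is_projective_module ?S (ideal_module ?S ?J')"
    by (rule ideal_module_projective_transfer[OF J J' \<theta> \<theta>_J])
      (use wt in \<open>simp add: well_tempered_def Let_def\<close>)
  \<comment> \<open>The right-hand condition follows from the same \<open>\<theta>\<close>, which is
    also an isomorphism of the opposite rings; the augmentation ideals, being two-sided, remain
    ideals there.\<close>
  moreover have "is_projective_module (opposite_ring ?S) (ideal_module (opposite_ring ?S) ?J')"
    by (rule ideal_module_projective_transfer[OF ideal_opposite_ring[OF J] ideal_opposite_ring[OF J']
          ring_iso_opposite_ring[OF \<theta>] \<theta>_J])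
      (use wt in \<open>simp add: well_tempered_def Let_def\<close>)
  \<comment> \<open>With \<open>\<phi>\<close> in all three roles, the compatibility required is its
    multiplicativity between the homotopes.\<close>
  moreover have "tensor_lift K ?D (mult ?D) ` carrier (tensor_product K ?D ?D) = carrier ?D"
    by (rule bilinear_map.tensor_lift_surj_transfer[OF bilinear_map_homotope[OF \<Delta>']
          bilinear_map_homotope[OF \<Delta>], where p = \<phi> and q = \<phi> and r = \<phi>])
      (use wt \<phi>_hom \<phi>_surj \<phi>_mult in \<open>auto simp: well_tempered_def Let_def homotope_def\<close>)
  ultimately show ?thesis
    by (simp add: well_tempered_def Let_def)
qed

end

theorem lemma20:
  assumes "unital_algebra K A"
    and "is_free_module K A"
    and "\<Delta> \<in> carrier A"
    and "c \<in> Units A"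
    and "d \<in> Units A"
  shows "well_tempered K A \<Delta> \<longleftrightarrow> well_tempered K A (c \<otimes>\<^bsub>A\<^esub> \<Delta> \<otimes>\<^bsub>A\<^esub> d)"
proof -
  interpret unital_algebra K A by fact
  have cd: "c \<in> carrier A" "d \<in> carrier A" "inv\<^bsub>A\<^esub> c \<in> carrier A" "inv\<^bsub>A\<^esub> d \<in> carrier A"
    using assms(4,5) by (auto intro: A.Units_closed)
  \<comment> \<open>Multiplying by the inverse units recovers \<open>\<Delta>\<close> from
    \<open>c \<Delta> d\<close>, so the forward direction is the implication above with
    \<open>c \<Delta> d\<close> in the place of \<open>\<Delta>\<close>.\<close>
  have "inv\<^bsub>A\<^esub> c \<otimes>\<^bsub>A\<^esub> (c \<otimes>\<^bsub>A\<^esub> \<Delta> \<otimes>\<^bsub>A\<^esub> d) \<otimes>\<^bsub>A\<^esub> inv\<^bsub>A\<^esub> d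
      = (inv\<^bsub>A\<^esub> c \<otimes>\<^bsub>A\<^esub> c) \<otimes>\<^bsub>A\<^esub> \<Delta> \<otimes>\<^bsub>A\<^esub> (d \<otimes>\<^bsub>A\<^esub> inv\<^bsub>A\<^esub> d)"
    using cd assms(3) by (simp add: A.m_assoc)
  also have "\<dots> = \<Delta>"
    using assms(3-5) by simp
  finally show ?thesis
    using well_tempered_mult_units_imp[of \<Delta> c d]
      well_tempered_mult_units_imp[of "c \<otimes>\<^bsub>A\<^esub> \<Delta> \<otimes>\<^bsub>A\<^esub> d" "inv\<^bsub>A\<^esub> c" "inv\<^bsub>A\<^esub> d"]
      cd assms(3-5) by auto
qed

end
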